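(* Let $n,m\ge3$ be odd integers and let $S$ and $T$ be 2-partitions of $\mathbb{Z}_n^*$ and $\mathbb{Z}_m^*$ respectively, and let $W_{ST}$ be any product of $S$ and $T$. Then $W_{ST}$ is skew if and only if both $S$ and $T$ are skew.
   Context: $\mathbb{Z}_k^*=\mathbb{Z}_k\setminus\{0\}$; a 2-partition of $\mathbb{Z}_k^*$ ($k$ odd) is a partition into unordered pairs $\{x_i,y_i\}$. It is skew if $\{\pm(x_i+y_i)\bmod k\}=\mathbb{Z}_k^*$. Product: let $n=2q+1$, $m=2p+1$. Let $\tilde S$ be any set of ordered pairs obtained by ordering each pair of $S$ in either way. Let $\bar T=\{(r_j,t_j)\}_{j=1}^p$ be obtained by ordering each pair of $T$ so that $\bigcup_j\{\pm r_j\}=\mathbb{Z}_m^*$, and $\bar T'=\{(-r_j,-t_j)\}_{j=1}^p$. A product $W_{ST}$ is the collection of unordered pairs $\{nr+x,\ nt+y\}$ (mod $nm$, with $x,y$ represented in $\{0,\dots,n-1\}$) of two types: (i) one pair for each $(r,t)\in\bar T\cup\bar T'\cup\{(0,0)\}$ and each $(x,y)\in\tilde S$; (ii) one pair for each $(r,t)\in\bar T$ with $x=y=0$. It is a 2-partition of $\mathbb{Z}_{nm}^*$. *)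

theory Defs
  imports Main "HOL-Library.Disjoint_Sets"
begin

text \<open>Residues modulo \<open>k\<close> are represented by the integers \<open>0, \<dots>, k - 1\<close>.\<close>

definition Zstar :: "int \<Rightarrow> int set" where
  "Zstar k = {0..<k} - {0}"

definition two_partition :: "int \<Rightarrow> int set set \<Rightarrow> bool" where
  "two_partition k S \<longleftrightarrow> partition_on (Zstar k) S \<and> (\<forall>P\<in>S. card P = 2)"

definition skew :: "int \<Rightarrow> int set set \<Rightarrow> bool" where
  "skew k S \<longleftrightarrow>
     {(x + y) mod k |x y. {x, y} \<in> S} \<union> {(- (x + y)) mod k |x y. {x, y} \<in> S} = Zstar k"

text \<open>A set of ordered pairs that contains each pair of \<open>S\<close> in exactly one of its two orders.\<close>

definition ordering_of :: "int set set \<Rightarrow> (int \<times> int) set \<Rightarrow> bool" where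
  "ordering_of S R \<longleftrightarrow> bij_betw (\<lambda>(x, y). {x, y}) R S"

text \<open>Additionally, the first entries are representatives of \<open>Zstar m\<close> up to sign.\<close>

definition signed_ordering_of :: "int \<Rightarrow> int set set \<Rightarrow> (int \<times> int) set \<Rightarrow> bool" where
  "signed_ordering_of m T R \<longleftrightarrow>
     ordering_of T R \<and> (\<Union>(r, t)\<in>R. {r mod m, (- r) mod m}) = Zstar m"

definition neg_pairs :: "int \<Rightarrow> (int \<times> int) set \<Rightarrow> (int \<times> int) set" where
  "neg_pairs m R = (\<lambda>(r, t). ((- r) mod m, (- t) mod m)) ` R"

definition product_pairs ::
  "int \<Rightarrow> int \<Rightarrow> (int \<times> int) set \<Rightarrow> (int \<times> int) set \<Rightarrow> int set set" where
  "product_pairs n m S' T' =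
     {{(n * r + x) mod (n * m), (n * t + y) mod (n * m)} |r t x y.
        (r, t) \<in> T' \<union> neg_pairs m T' \<union> {(0, 0)} \<and> (x, y) \<in> S'} \<union>
     {{(n * r) mod (n * m), (n * t) mod (n * m)} |r t. (r, t) \<in> T'}"

text \<open>A product of \<open>S\<close> and \<open>T\<close> depends on the chosen orderings, hence a relation.\<close>

definition is_product ::
  "int \<Rightarrow> int \<Rightarrow> int set set \<Rightarrow> int set set \<Rightarrow> int set set \<Rightarrow> bool" where
  "is_product n m S T W \<longleftrightarrow>
     (\<exists>S' T'. ordering_of S S' \<and> signed_ordering_of m T T' \<and> W = product_pairs n m S' T')"

end

theory Submission imports Defs begin

text \<open>
  Skewness of \<open>S\<close> says that the sums of its pairs represent every nonzero residue up to sign and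
  never represent \<open>0\<close>.  Modulo \<open>n * m\<close>, the sums of a product are \<open>n * u + d\<close> with \<open>u\<close> zero or,
  up to sign, a sum of \<open>T\<close>, and \<open>d\<close> a sum of \<open>S\<close>, together with \<open>n * e\<close> for the sums \<open>e\<close> of \<open>T\<close>.
  Residues not divisible by \<open>n\<close> come from the first kind.  If the product is skew, they force the
  sums of \<open>S\<close> to cover \<open>Zstar n\<close> up to sign; as there are only \<open>(n - 1) / 2\<close> of them, none is
  divisible by \<open>n\<close>.  Hence the multiples of \<open>n\<close> come from the second kind only.
\<close>

section \<open>Sets representing the nonzero residues up to sign\<close>

text \<open>The elements are arbitrary integers rather than reduced residues, so that sums such as
  \<open>n * u + d\<close> can be used as they stand. Repeated representatives are allowed.\<close>

definition half_system :: "int \<Rightarrow> int set \<Rightarrow> bool" where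
  "half_system k D \<longleftrightarrow> (\<forall>d\<in>D. \<not> k dvd d) \<and>
     (\<forall>z. \<not> k dvd z \<longrightarrow> (\<exists>d\<in>D. k dvd z - d \<or> k dvd z + d))"

lemma half_system_mod_image: "half_system k ((\<lambda>d. d mod k) ` D) \<longleftrightarrow> half_system k D"
  by (simp add: half_system_def dvd_eq_mod_eq_0 mod_simps)

lemma half_system_cong:
  assumes "(\<lambda>d. d mod k) ` D = (\<lambda>d. d mod k) ` D'"
  shows "half_system k D \<longleftrightarrow> half_system k D'"
  using half_system_mod_image[of k D] half_system_mod_image[of k D'] assms by simp

lemma mod_mem_Zstar_iff: "k > 0 \<Longrightarrow> d mod k \<in> Zstar k \<longleftrightarrow> \<not> k dvd d"
  by (auto simp: Zstar_def dvd_eq_mod_eq_0)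

lemma half_system_iff_Zstar:
  assumes "k > 0"
  shows "half_system k D \<longleftrightarrow> (\<lambda>d. d mod k) ` D \<union> (\<lambda>d. (- d) mod k) ` D = Zstar k"
    (is "_ \<longleftrightarrow> ?A = _")
proof -
  have "?A \<subseteq> Zstar k \<longleftrightarrow> (\<forall>d\<in>D. \<not> k dvd d)"
    using mod_mem_Zstar_iff[OF assms] by (simp add: image_subset_iff)
  moreover have "Zstar k \<subseteq> ?A \<longleftrightarrow>
      (\<forall>z. \<not> k dvd z \<longrightarrow> (\<exists>d\<in>D. k dvd z - d \<or> k dvd z + d))"
  proof -
    have mem: "z mod k \<in> ?A \<longleftrightarrow> (\<exists>d\<in>D. k dvd z - d \<or> k dvd z + d)" for z
    proof -
      have "z mod k \<in> ?A \<longleftrightarrow> (\<exists>d\<in>D. z mod k = d mod k \<or> z mod k = (- d) mod k)"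
        by blast
      then show ?thesis
        unfolding mod_eq_dvd_iff by simp
    qed
    \<comment> \<open>Every element of \<open>Zstar k\<close> is its own residue, so a condition on
      all integers with residue in \<open>Zstar k\<close> is one on \<open>Zstar k\<close>
      itself.\<close>
    have "(\<forall>z. z mod k \<in> Zstar k \<longrightarrow> z mod k \<in> B) \<longleftrightarrow> Zstar k \<subseteq> B" for B
    proof -
      have "z mod k = z" if "z \<in> Zstar k" for z
        using that by (simp add: Zstar_def)
      then have "z \<in> B" if "\<forall>z. z mod k \<in> Zstar k \<longrightarrow> z mod k \<in> B" "z \<in> Zstar k" for z
        using that(1)[rule_format, of z] that(2) by simp
      then show ?thesis by blast
    qed
    from this[of ?A] show ?thesis
      unfolding mem mod_mem_Zstar_iff[OF assms] by (rule sym)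
  qed
  ultimately show ?thesis
    unfolding half_system_def by (simp only: set_eq_subset)
qed

text \<open>The sum of a pair does not depend on its order, so the ordered pairs yield the same sums
  as the unordered ones.\<close>

lemma skew_iff_half_system:
  assumes "k > 0"
  shows "skew k ((\<lambda>(x, y). {x, y}) ` R) \<longleftrightarrow> half_system k ((\<lambda>(x, y). x + y) ` R)"
proof -
  let ?S = "(\<lambda>(x, y). {x, y}) ` R" and ?D = "(\<lambda>(x, y). x + y) ` R"
  have image_sums: "f ` {x + y |x y. P x y} = {f (x + y) |x y. P x y}" for f :: "int \<Rightarrow> int" and P
    by blast
  have sums: "{x + y |x y. {x, y} \<in> ?S} = ?D"
    by (force simp: doubleton_eq_iff)
  have "{(x + y) mod k |x y. {x, y} \<in> ?S} = (\<lambda>d. d mod k) ` ?D"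
    "{(- (x + y)) mod k |x y. {x, y} \<in> ?S} = (\<lambda>d. (- d) mod k) ` ?D"
    unfolding sums[symmetric] by (rule image_sums[symmetric])+
  then show ?thesis
    unfolding skew_def half_system_iff_Zstar[OF assms] by simp
qed

text \<open>Pigeonhole: an element divisible by \<open>k\<close> represents no nonzero residue and
  could be dropped. The other \<open>card D - 1\<close> elements yield, with both signs, at most
  \<open>k - 3\<close> residues, too few for the \<open>k - 1\<close> elements of
  \<open>Zstar k\<close>.\<close>

lemma covering_card_imp_not_dvd:
  assumes "k > 0" "finite D" "2 * int (card D) \<le> k - 1"
    and cover: "\<And>z. \<not> k dvd z \<Longrightarrow> \<exists>d\<in>D. k dvd z - d \<or> k dvd z + d"
    and "d \<in> D"
  shows "\<not> k dvd d"
proof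
  assume "k dvd d"
  let ?E = "D - {d}"
  have "Zstar k \<subseteq> (\<lambda>d. d mod k) ` ?E \<union> (\<lambda>d. (- d) mod k) ` ?E" (is "_ \<subseteq> ?A")
  proof
    fix z assume z: "z \<in> Zstar k"
    then have zk: "z mod k = z" and nz: "\<not> k dvd z"
      using mod_mem_Zstar_iff[OF \<open>k > 0\<close>, of z] by (auto simp: Zstar_def)
    obtain e where e: "e \<in> D" "k dvd z - e \<or> k dvd z + e"
      using cover[OF nz] by blast
    have "e \<noteq> d"
      using e(2) nz \<open>k dvd d\<close> by (metis dvd_add_left_iff dvd_diff_left_iff)
    moreover have "z = e mod k \<or> z = (- e) mod k"
      using e(2) zk mod_eq_dvd_iff[of z k e] mod_eq_dvd_iff[of z k "- e"] by auto
    ultimately show "z \<in> ?A"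
      using e(1) by blast
  qed
  then have "card (Zstar k) \<le> card ?A"
    using \<open>finite D\<close> by (intro card_mono) auto
  also have "\<dots> \<le> card ?E + card ?E"
    using \<open>finite D\<close> by (intro order_trans[OF card_Un_le] add_mono card_image_le) auto
  finally have "card (Zstar k) \<le> 2 * (card D - 1)"
    using \<open>d \<in> D\<close> \<open>finite D\<close> by simp
  moreover have "int (card (Zstar k)) = k - 1"
    using \<open>k > 0\<close> by (simp add: Zstar_def card_Diff_singleton)
  moreover have "card D > 0"
    using \<open>d \<in> D\<close> \<open>finite D\<close> card_gt_0_iff by blast
  ultimately show False
    using assms(3) by linarith
qed

section \<open>Passing between the moduli \<open>n\<close>, \<open>m\<close> and
  \<open>n * m\<close>\<close>

lemma half_system_product_iff:
  assumes "n > 0" "m > 0" "finite D" "2 * int (card D) \<le> n - 1"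
  shows "half_system (n * m) ((\<lambda>(u, d). n * u + d) ` ((E \<union> uminus ` E \<union> {0}) \<times> D) \<union> (*) n ` E)
    \<longleftrightarrow> half_system n D \<and> half_system m E"
    (is "half_system _ (?F \<union> ?G) \<longleftrightarrow> _")
proof -
  \<comment> \<open>The condition on \<open>D\<close> stays a premise: in the forward direction it
    comes from counting, in the backward direction from the assumption on \<open>D\<close>.\<close>
  have F_ndvd: "\<not> n dvd w" if "\<And>d. d \<in> D \<Longrightarrow> \<not> n dvd d" "w \<in> ?F" for w
  proof -
    obtain u d where "d \<in> D" "w = n * u + d"
      using \<open>w \<in> ?F\<close> by auto
    then show ?thesis
      using that(1) by (simp add: dvd_add_right_iff)
  qed
  show ?thesis
  proof
    assume "half_system (n * m) (?F \<union> ?G)"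
    note W = this[unfolded half_system_def, THEN conjunct1, rule_format]
      this[unfolded half_system_def, THEN conjunct2, rule_format]
    have n_cover: "\<exists>d\<in>D. n dvd z - d \<or> n dvd z + d" if "\<not> n dvd z" for z
    proof -
      have "\<not> n * m dvd z"
        using that dvd_mult_left by blast
      from W(2)[OF this]
      obtain w where w: "w \<in> ?F \<union> ?G" "n * m dvd z - w \<or> n * m dvd z + w"
        by (elim bexE)
      then have wn: "n dvd z - w \<or> n dvd z + w"
        using dvd_mult_left by blast
      with that have "\<not> n dvd w"
        by (metis dvd_add_left_iff dvd_diff_left_iff)
      \<comment> \<open>All elements of \<open>?G\<close> are multiples of \<open>n\<close>, so
        \<open>w\<close> lies in \<open>?F\<close>, and \<open>n * u\<close> vanishes modulo
        \<open>n\<close>.\<close>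
      then obtain u d where "d \<in> D" "w = n * u + d"
        using w(1) by auto
      moreover from this wn have "n dvd z - d \<or> n dvd z + d"
        using dvd_add_right_iff[of n "n * u" "z + d"] dvd_diff_left_iff[of n "n * u" "z - d"]
        by (auto simp: algebra_simps)
      ultimately show ?thesis by blast
    qed
    then have n_ndvd: "\<not> n dvd d" if "d \<in> D" for d
      using covering_card_imp_not_dvd assms that by blast
    have "\<not> m dvd e" if "e \<in> E" for e
      using W(1)[of "n * e"] that \<open>n > 0\<close> by auto
    \<comment> \<open>A multiple \<open>n * b\<close> is represented only by a multiple of
      \<open>n\<close>, hence from \<open>?G\<close>; cancelling \<open>n\<close> leaves a
      representation of \<open>b\<close> modulo \<open>m\<close>.\<close>
    moreover have "\<exists>e\<in>E. m dvd b - e \<or> m dvd b + e" if "\<not> m dvd b" for b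
    proof -
      have "\<not> n * m dvd n * b"
        using that \<open>n > 0\<close> by simp
      from W(2)[OF this]
      obtain w where w: "w \<in> ?F \<union> ?G" "n * m dvd n * b - w \<or> n * m dvd n * b + w"
        by (elim bexE)
      then have "n dvd n * b - w \<or> n dvd n * b + w"
        using dvd_mult_left by blast
      then have "n dvd w"
        by (metis dvd_add_right_iff dvd_diff_right_iff dvd_triv_left)
      then obtain e where "e \<in> E" "w = n * e"
        using w(1) F_ndvd[OF n_ndvd] by blast
      then show ?thesis
        using w(2) \<open>n > 0\<close> by (auto simp flip: right_diff_distrib distrib_left)
    qed
    ultimately show "half_system n D \<and> half_system m E"
      using n_cover n_ndvd unfolding half_system_def by blast
  next
    assume "half_system n D \<and> half_system m E"
    then have D: "\<And>d. d \<in> D \<Longrightarrow> \<not> n dvd d"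
        "\<And>z. \<not> n dvd z \<Longrightarrow> \<exists>d\<in>D. n dvd z - d \<or> n dvd z + d"
      and E: "\<And>e. e \<in> E \<Longrightarrow> \<not> m dvd e"
        "\<And>z. \<not> m dvd z \<Longrightarrow> \<exists>e\<in>E. m dvd z - e \<or> m dvd z + e"
      unfolding half_system_def by blast+
    have "\<not> n * m dvd w" if "w \<in> ?F \<union> ?G" for w
      using that
    proof
      assume "w \<in> ?F"
      then show ?thesis
        using F_ndvd[OF D(1)] dvd_mult_left by blast
    next
      assume "w \<in> ?G"
      then show ?thesis
        using E(1) \<open>n > 0\<close> by auto
    qed
    moreover have "\<exists>w\<in>?F \<union> ?G. n * m dvd z - w \<or> n * m dvd z + w" if nz: "\<not> n * m dvd z" for z
    proof (cases "n dvd z")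
      case True
      then obtain b where b: "z = n * b" by blast
      with nz \<open>n > 0\<close> have "\<not> m dvd b" by simp
      then obtain e where e: "e \<in> E" "m dvd b - e \<or> m dvd b + e"
        using E(2) by blast
      then have "n * m dvd z - n * e \<or> n * m dvd z + n * e"
        unfolding b right_diff_distrib[symmetric] distrib_left[symmetric] by (auto intro: mult_dvd_mono)
      with e(1) show ?thesis by blast
    next
      case False
      \<comment> \<open>The sign of \<open>d\<close> is fixed already, so the quotient
        \<open>k\<close> must be matched modulo \<open>m\<close> exactly, not just up to sign. This
        is why \<open>E\<close> enters with both signs; \<open>0\<close> serves the case
        \<open>m dvd k\<close>.\<close>
      have lift: "\<exists>u\<in>E \<union> uminus ` E \<union> {0}. n * m dvd y - (n * u + d)" if "n dvd y - d" for y d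
      proof -
        obtain k where k: "y - d = n * k" using \<open>n dvd y - d\<close> by blast
        have "\<exists>u\<in>E \<union> uminus ` E \<union> {0}. m dvd k - u"
        proof (cases "m dvd k")
          case False
          then obtain e where "e \<in> E" "m dvd k - e \<or> m dvd k - (- e)"
            using E(2) by fastforce
          then show ?thesis by blast
        qed simp
        then obtain u where u: "u \<in> E \<union> uminus ` E \<union> {0}" "m dvd k - u" by blast
        have "y - (n * u + d) = n * (k - u)"
          using k by (simp add: algebra_simps)
        with u show ?thesis by (metis mult_dvd_mono dvd_refl)
      qed
      obtain d where d: "d \<in> D" "n dvd z - d \<or> n dvd z + d"
        using D(2)[OF False] by blast
      \<comment> \<open>If \<open>d\<close> represents \<open>z\<close> with the opposite sign, then
        \<open>- z\<close> is lifted instead and the result negated.\<close>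
      then have "n dvd z - d \<or> n dvd - z - d"
        by (metis dvd_minus_iff minus_add_distrib uminus_add_conv_diff add.commute)
      then obtain u where u: "u \<in> E \<union> uminus ` E \<union> {0}"
        "n * m dvd z - (n * u + d) \<or> n * m dvd - z - (n * u + d)"
        using lift by blast
      have "- z - (n * u + d) = - (z + (n * u + d))" by simp
      with u(2) have "n * m dvd z - (n * u + d) \<or> n * m dvd z + (n * u + d)"
        by (metis dvd_minus_iff)
      moreover have "n * u + d \<in> ?F"
        by (rule image_eqI[of _ _ "(u, d)"]) (use u(1) d(1) in simp_all)
      ultimately show ?thesis by blast
    qed
    ultimately show "half_system (n * m) (?F \<union> ?G)"
      unfolding half_system_def by blast
  qed
qed

section \<open>Sums of the pairs of a product\<close>

text \<open>The pair \<open>(n * r + x, n * t + y)\<close> has sum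
  \<open>n * (r + t) + (x + y)\<close>, of which only the residue modulo \<open>n * m\<close>
  matters. Negated pairs account for the negatives of \<open>E\<close>, and \<open>(0, 0)\<close>
  for \<open>0\<close>.\<close>

lemma skew_product_pairs_iff_half_system:
  fixes S' T' :: "(int \<times> int) set"
  assumes "n > 0" "m > 0"
  defines "D \<equiv> (\<lambda>(x, y). x + y) ` S'" and "E \<equiv> (\<lambda>(r, t). r + t) ` T'"
  shows "skew (n * m) (product_pairs n m S' T') \<longleftrightarrow>
    half_system (n * m) ((\<lambda>(u, d). n * u + d) ` ((E \<union> uminus ` E \<union> {0}) \<times> D) \<union> (*) n ` E)"
proof -
  let ?red = "\<lambda>a. a mod (n * m)"
  let ?U = "T' \<union> neg_pairs m T' \<union> {(0, 0)}"
  \<comment> \<open>The ordered pairs of the product before reduction modulo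
    \<open>n * m\<close>.\<close>
  define V where "V = (\<lambda>((r, t), (x, y)). (n * r + x, n * t + y)) ` (?U \<times> S') \<union>
    (\<lambda>(r, t). (n * r, n * t)) ` T'"
  have type_i: "{{f (n * r + x), f (n * t + y)} |r t x y. (r, t) \<in> U \<and> (x, y) \<in> S'} =
      (\<lambda>(x, y). {x, y}) ` map_prod f f ` (\<lambda>((r, t), (x, y)). (n * r + x, n * t + y)) ` (U \<times> S')"
    for f :: "int \<Rightarrow> int" and U
    unfolding image_image by (simp add: set_eq_iff image_iff Bex_def) blast
  have type_ii: "{{f (n * r), f (n * t)} |r t. (r, t) \<in> T'} =
      (\<lambda>(x, y). {x, y}) ` map_prod f f ` (\<lambda>(r, t). (n * r, n * t)) ` T'" for f :: "int \<Rightarrow> int"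
    unfolding image_image by (simp add: set_eq_iff image_iff Bex_def) blast
  have "product_pairs n m S' T' = (\<lambda>(x, y). {x, y}) ` map_prod ?red ?red ` V"
    unfolding product_pairs_def V_def image_Un type_i[symmetric] type_ii[symmetric] ..
  then have "skew (n * m) (product_pairs n m S' T') \<longleftrightarrow>
      half_system (n * m) ((\<lambda>(x, y). x + y) ` map_prod ?red ?red ` V)"
    using skew_iff_half_system[of "n * m"] assms by simp
  also have "\<dots> \<longleftrightarrow> half_system (n * m) ((\<lambda>(x, y). x + y) ` V)"
    by (intro half_system_cong) (simp add: image_image case_prod_unfold mod_simps)
  also have "\<dots> \<longleftrightarrow>
    half_system (n * m) ((\<lambda>(u, d). n * u + d) ` ((E \<union> uminus ` E \<union> {0}) \<times> D) \<union> (*) n ` E)"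
  proof (rule half_system_cong)
    \<comment> \<open>\<open>neg_pairs\<close> reduces its entries modulo \<open>m\<close>; after
      multiplication by \<open>n\<close> this changes a sum only by a multiple of
      \<open>n * m\<close>.\<close>
    have neg: "?red (n * ((- r) mod m + (- t) mod m) + d) = ?red (n * - (r + t) + d)" for r t d
    proof -
      have "?red (n * ((- r) mod m + (- t) mod m)) = ?red (n * - (r + t))"
        unfolding mult_mod_right[symmetric] by (simp add: mod_simps)
      then show ?thesis
        by (rule mod_add_cong) simp
    qed
    have red_U: "(\<lambda>(r, t). ?red (n * (r + t) + d)) ` ?U =
        (\<lambda>u. ?red (n * u + d)) ` (E \<union> uminus ` E \<union> {0})" for d
      unfolding E_def neg_pairs_def image_Un image_image
      by (simp add: case_prod_unfold neg)
    \<comment> \<open>Grouping the sums by the pair \<open>(x, y)\<close> brings each group into the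
      form that \<open>red_U\<close> rewrites.\<close>
    have "?red ` (\<lambda>(x, y). x + y) ` V =
        (\<Union>(x, y)\<in>S'. (\<lambda>(r, t). ?red (n * (r + t) + (x + y))) ` ?U) \<union>
        (\<lambda>(r, t). ?red (n * (r + t))) ` T'"
      unfolding V_def image_Un image_image
      by (intro arg_cong2[where f = "(\<union>)"])
        (force simp: image_iff algebra_simps case_prod_unfold)+
    also have "\<dots> = ?red ` ((\<lambda>(u, d). n * u + d) ` ((E \<union> uminus ` E \<union> {0}) \<times> D) \<union> (*) n ` E)"
      unfolding red_U unfolding E_def D_def image_Un image_image
      by (intro arg_cong2[where f = "(\<union>)"]) (force simp: image_iff case_prod_unfold)+
    finally show "?red ` (\<lambda>(x, y). x + y) ` V =
      ?red ` ((\<lambda>(u, d). n * u + d) ` ((E \<union> uminus ` E \<union> {0}) \<times> D) \<union> (*) n ` E)" .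
  qed
  finally show ?thesis .
qed

lemma two_partition_card:
  assumes "two_partition k S" "k > 0"
  shows "finite S" "2 * int (card S) = k - 1"
proof -
  have P: "partition_on (Zstar k) S" and two: "\<And>P. P \<in> S \<Longrightarrow> card P = 2"
    using assms(1) by (auto simp: two_partition_def)
  have fin: "finite (Zstar k)" by (simp add: Zstar_def)
  show "finite S"
    using finite_elements[OF fin P] .
  have "card (Zstar k) = (\<Sum>P\<in>S. card P)"
    using product_partition[OF P] two by (simp add: card_ge_0_finite)
  also have "\<dots> = 2 * card S"
    using two by simp
  finally show "2 * int (card S) = k - 1"
    using \<open>k > 0\<close> by (simp add: Zstar_def card_Diff_singleton)
qed

theorem theorem3p8:
  fixes n m :: int and S T W :: "int set set"
  assumes "n \<ge> 3" and "odd n" and "m \<ge> 3" and "odd m"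
    and "two_partition n S" and "two_partition m T"
    and "is_product n m S T W"
  shows "skew (n * m) W \<longleftrightarrow> skew n S \<and> skew m T"
proof -
  obtain S' T' where bS: "bij_betw (\<lambda>(x, y). {x, y}) S' S"
    and bT: "bij_betw (\<lambda>(x, y). {x, y}) T' T" and W: "W = product_pairs n m S' T'"
    using assms(7) unfolding is_product_def signed_ordering_of_def ordering_of_def by blast
  let ?D = "(\<lambda>(x, y). x + y) ` S'" and ?E = "(\<lambda>(r, t). r + t) ` T'"
  have pos: "n > 0" "m > 0"
    using assms by auto
  have finS': "finite S'"
    using bij_betw_finite[OF bS] two_partition_card(1)[OF assms(5) pos(1)] by simp
  have "2 * int (card S') = n - 1"
    using bij_betw_same_card[OF bS] two_partition_card(2)[OF assms(5) pos(1)] by simp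
  \<comment> \<open>Distinct pairs may share a sum, so equality weakens to an upper bound.\<close>
  then have "2 * int (card ?D) \<le> n - 1"
    using card_image_le[OF finS', of "\<lambda>(x, y). x + y"] by linarith
  then have "skew (n * m) W \<longleftrightarrow> half_system n ?D \<and> half_system m ?E"
    unfolding W skew_product_pairs_iff_half_system[OF pos]
    by (intro half_system_product_iff pos finite_imageI finS')
  also have "\<dots> \<longleftrightarrow> skew n S \<and> skew m T"
    using skew_iff_half_system[OF pos(1), of S'] skew_iff_half_system[OF pos(2), of T']
      bij_betw_imp_surj_on[OF bS] bij_betw_imp_surj_on[OF bT] by simp
  finally show ?thesis .
qed

end
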